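(* Let $\widehat{x}\in S$. The following statements hold true: (i) If $\vartheta(\widehat{x},\xi,\lambda)=0$ for some $\xi:=(\xi_1,\ldots,\xi_p)\in\prod_{i=1}^{p}\partial f_i(\widehat{x})$ and $\lambda>0_p$, then $\widehat{x}$ is an efficient solution for $(P)$. (ii) If $\widehat{x}$ is an efficient solution for $(P)$ where the extended Abadie data qualification (EADQ) and the Maeda objective qualification (MOQ) hold, then there exist $\xi\in\prod_{i=1}^{p}\partial f_i(\widehat{x})$ and $\lambda>0_p$ such that $\vartheta(\widehat{x},\xi,\lambda)=0$.
   Context: Setting: $p\geq 2$, $I:=\{1,\ldots,p\}$; $f_i:\mathbb{R}^n\to\mathbb{R}$ ($i\in I$) are finite-valued convex functions; $T$ is an infinite index set; for each $t\in T$, $g_t:\mathbb{R}^n\to\mathbb{R}\cup\{+\infty\}$ is a lower semicontinuous proper convex function. Problem $(P)$: minimize $f(x):=(f_1(x),\ldots,f_p(x))$ subject to $g_t(x)\le 0$, $t\in T$, with feasible set $S:=\{x\in\mathbb{R}^n\mid g_t(x)\le 0\ \forall t\in T\}$ assumed nonempty. $\widehat{x}\in S$ is an efficient solution of $(P)$ if there is no $x\in S$ with $f_i(x)\le f_i(\widehat{x})$ for all $i\in I$ and $f(x)\neq f(\widehat{x})$. For $\lambda\in\mathbb{R}^p$, $\lambda>0_p$ means $\lambda_i>0$ for all $i\in I$. The gap function is $$\vartheta(x,\xi,\lambda):=\sup_{y\in S}\Big\{\sum_{i=1}^{p}\lambda_i\,\xi_i'(x-y)\Big\}\in[-\infty,+\infty]$$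 for $x\in\mathbb{R}^n$, $\xi=(\xi_1,\ldots,\xi_p)\in\prod_{i=1}^p\partial f_i(x)$, and such $\lambda$. Notation: $\partial$ is the Fenchel–Moreau subdifferential; for nonempty $M\subseteq\mathbb{R}^n$, $M^{0}:=\{d\mid x'd\le 0\ \forall x\in M\}$ and $M^{-}:=\{d\mid x'd<0\ \forall x\in M\}$; for $\widehat{x}\in M$, $C(M,\widehat{x}):=\{v\mid\exists t_r\downarrow0,\ \exists v_r\to v:\ \widehat{x}+t_rv_r\in M\ \forall r\in\mathbb{N}\}$. $T(\widehat{x}):=\{t\in T\mid g_t(\widehat{x})=0\}$; $F(\widehat{x}):=\bigcup_{i=1}^p\partial f_i(\widehat{x})$; $G(\widehat{x}):=\bigcup_{t\in T(\widehat{x})}\partial g_t(\widehat{x})$; $F^{0}(\widehat{x}):=(F(\widehat{x}))^0$, $G^{0}(\widehat{x}):=(G(\widehat{x}))^0$; $Q^{i}(\widehat{x}):=\{x\in S\mid f_l(x)\le f_l(\widehat{x})\ \forall l\in I\setminus\{i\}\}$. EADQ holds at $\widehat{x}$ when $G(\widehat{x})\neq\emptyset$ and $F^{0}(\widehat{x})\cap G^{0}(\widehat{x})\subseteq\bigcap_{i=1}^{p}C(Q^{i}(\widehat{x}),\widehat{x})$. MOQ holds at $\widehat{x}$ when $F^{0}(\widehat{x})\subseteq\{0_n\}\cup\bigcup_{i=1}^{p}(\partial f_i(\widehat{x}))^{-}$. *)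

theory Defs
  imports "HOL-Analysis.Analysis"
begin

definition proper_fun :: "('a \<Rightarrow> ereal) \<Rightarrow> bool" where
  "proper_fun h \<longleftrightarrow> (\<forall>x. h x \<noteq> -\<infinity>) \<and> (\<exists>x. h x \<noteq> \<infinity>)"

(* Convexity through the epigraph: the library's convex_on covers real-valued functions only. *)
definition convex_fun :: "('a::real_vector \<Rightarrow> ereal) \<Rightarrow> bool" where
  "convex_fun h \<longleftrightarrow> convex {(x, r::real). h x \<le> ereal r}"

definition lsc_fun :: "('a::topological_space \<Rightarrow> ereal) \<Rightarrow> bool" where
  "lsc_fun h \<longleftrightarrow> (\<forall>x. h x \<le> Liminf (at x) h)"

(* As usual, the subdifferential is empty at points where h is not finite. *)
definition subdiff :: "('a::real_inner \<Rightarrow> ereal) \<Rightarrow> 'a \<Rightarrow> 'a set" where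
  "subdiff h x =
     {\<xi>. \<bar>h x\<bar> \<noteq> \<infinity> \<and> (\<forall>y. h x + ereal (inner \<xi> (y - x)) \<le> h y)}"

definition polar_cone :: "'a::real_inner set \<Rightarrow> 'a set" where
  "polar_cone M = {d. \<forall>x\<in>M. inner x d \<le> 0}"

definition strict_polar_cone :: "'a::real_inner set \<Rightarrow> 'a set" where
  "strict_polar_cone M = {d. \<forall>x\<in>M. inner x d < 0}"

definition contingent_cone :: "'a::real_normed_vector set \<Rightarrow> 'a \<Rightarrow> 'a set" where
  "contingent_cone M x =
     {v. \<exists>(t :: nat \<Rightarrow> real) w. (\<forall>r. 0 < t r) \<and> t \<longlonglongrightarrow> 0 \<and> w \<longlonglongrightarrow> v \<and>
           (\<forall>r. x + t r *\<^sub>R w r \<in> M)}"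

(* The p objectives are the components of one map f into real ^ 'p, so I is the finite type 'p;
   the constraints are g t for t in the index set T. *)

definition feasible_set :: "('t \<Rightarrow> real ^ 'n \<Rightarrow> ereal) \<Rightarrow> 't set \<Rightarrow> (real ^ 'n) set" where
  "feasible_set g T = {x. \<forall>t\<in>T. g t x \<le> 0}"

definition efficient ::
  "(real ^ 'n \<Rightarrow> real ^ 'p) \<Rightarrow> (real ^ 'n) set \<Rightarrow> real ^ 'n \<Rightarrow> bool" where
  "efficient f S x \<longleftrightarrow>
     x \<in> S \<and> \<not> (\<exists>y\<in>S. (\<forall>i. f y $ i \<le> f x $ i) \<and> f y \<noteq> f x)"

definition obj_subdiff :: "(real ^ 'n \<Rightarrow> real ^ 'p) \<Rightarrow> 'p \<Rightarrow> real ^ 'n \<Rightarrow> (real ^ 'n) set" where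
  "obj_subdiff f i x = subdiff (\<lambda>y. ereal (f y $ i)) x"

definition gap ::
  "(real ^ 'n) set \<Rightarrow> real ^ 'n \<Rightarrow> ('p::finite \<Rightarrow> real ^ 'n) \<Rightarrow> real ^ 'p \<Rightarrow> ereal" where
  "gap S x \<xi> l = (SUP y\<in>S. ereal (\<Sum>i\<in>UNIV. l $ i * inner (\<xi> i) (x - y)))"

definition active :: "('t \<Rightarrow> real ^ 'n \<Rightarrow> ereal) \<Rightarrow> 't set \<Rightarrow> real ^ 'n \<Rightarrow> 't set" where
  "active g T x = {t \<in> T. g t x = 0}"

definition obj_grads :: "(real ^ 'n \<Rightarrow> real ^ 'p) \<Rightarrow> real ^ 'n \<Rightarrow> (real ^ 'n) set" where
  "obj_grads f x = (\<Union>i. obj_subdiff f i x)"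

definition constr_grads ::
  "('t \<Rightarrow> real ^ 'n \<Rightarrow> ereal) \<Rightarrow> 't set \<Rightarrow> real ^ 'n \<Rightarrow> (real ^ 'n) set" where
  "constr_grads g T x = (\<Union>t\<in>active g T x. subdiff (g t) x)"

definition Q_set ::
  "(real ^ 'n \<Rightarrow> real ^ 'p) \<Rightarrow> (real ^ 'n) set \<Rightarrow> 'p \<Rightarrow> real ^ 'n \<Rightarrow> (real ^ 'n) set" where
  "Q_set f S i x = {y \<in> S. \<forall>l. l \<noteq> i \<longrightarrow> f y $ l \<le> f x $ l}"

definition EADQ ::
  "(real ^ 'n \<Rightarrow> real ^ 'p) \<Rightarrow> ('t \<Rightarrow> real ^ 'n \<Rightarrow> ereal) \<Rightarrow> 't set \<Rightarrow> real ^ 'n \<Rightarrow> bool" where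
  "EADQ f g T x \<longleftrightarrow> constr_grads g T x \<noteq> {} \<and>
     polar_cone (obj_grads f x) \<inter> polar_cone (constr_grads g T x)
       \<subseteq> (\<Inter>i. contingent_cone (Q_set f (feasible_set g T) i x) x)"

definition MOQ :: "(real ^ 'n \<Rightarrow> real ^ 'p) \<Rightarrow> real ^ 'n \<Rightarrow> bool" where
  "MOQ f x \<longleftrightarrow>
     polar_cone (obj_grads f x) \<subseteq> {0} \<union> (\<Union>i. strict_polar_cone (obj_subdiff f i x))"

end

theory Submission
  imports Defs
begin

text \<open>
  Statement (i) is the subgradient inequality: a feasible point dominating \<open>xh\<close> would make
  \<open>\<Sum>i. l $ i * inner (\<xi> i) (xh - y)\<close> positive.

  For (ii), let \<open>F\<close> and \<open>G\<close> be the sets of objective and active constraint subgradients at \<open>xh\<close>.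
  Every \<open>y - xh\<close> with \<open>y\<close> feasible lies in the polar cone of \<open>G\<close>, so the gap function vanishes as
  soon as the negative of some \<open>\<Sum>i. l $ i *\<^sub>R \<xi> i\<close> with positive weights lies in the bipolar cone
  of \<open>G\<close>. By separation (\<open>positive_multipliers_if_polar_trivial\<close>), such weights and subgradients
  exist if no nonzero direction \<open>d\<close> lies in the polar cones of both \<open>F\<close> and \<open>G\<close>.
  The hypotheses exclude such a \<open>d\<close>. By MOQ, \<open>d\<close> makes a negative inner product with
  all subgradients of some \<open>f\<^sub>i\<close>, hence \<open>f\<^sub>i\<close> drops below \<open>f\<^sub>i(xh)\<close> somewhere along the ray from \<open>xh\<close>
  in direction \<open>d\<close> (\<open>subgradient_of_no_descent\<close>). By EADQ, \<open>d\<close> is tangent to the set \<open>Q\<^sup>i\<close> of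
  feasible points at which no other objective has increased; convexity and continuity transfer
  the decrease to points of \<open>Q\<^sup>i\<close> close to \<open>xh\<close> (\<open>descent_along_contingent\<close>), contradicting
  efficiency.
\<close>

section \<open>A theorem of the alternative with positive multipliers\<close>

lemma slope_nonpos_of_bounded_ray:
  fixes a c :: real
  assumes "\<And>s. s > 0 \<Longrightarrow> c + s * a \<le> 0"
  shows "a \<le> 0"
proof (rule ccontr)
  assume "\<not> a \<le> 0"
  then have "a > 0" by simp
  have "(\<bar>c\<bar> + 1) / a > 0" using \<open>a > 0\<close> by simp
  from assms[OF this] have "c + \<bar>c\<bar> + 1 \<le> 0" using \<open>a > 0\<close> by simp
  then show False by linarith
qed

lemma convex_positive_multiples:
  fixes A :: "'a::real_vector set"
  assumes "convex A"
  shows "convex {s *\<^sub>R x |s x. s > 0 \<and> x \<in> A}"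
proof (rule convexI)
  fix v w and a b :: real
  assume v: "v \<in> {s *\<^sub>R x |s x. s > 0 \<and> x \<in> A}" and w: "w \<in> {s *\<^sub>R x |s x. s > 0 \<and> x \<in> A}"
    and ab: "0 \<le> a" "0 \<le> b" "a + b = 1"
  from v w obtain s x t y where sx: "s > 0" "x \<in> A" "v = s *\<^sub>R x"
    and ty: "t > 0" "y \<in> A" "w = t *\<^sub>R y" by blast
  let ?q = "a * s + b * t"
  have q: "?q > 0"
  proof (cases "a = 0")
    case True
    then show ?thesis using ab ty by simp
  next
    case False
    then have "a * s > 0" using ab sx by simp
    moreover have "b * t \<ge> 0" using ab ty by simp
    ultimately show ?thesis by linarith
  qed
  \<comment> \<open>The combination is a positive multiple of the point of \<open>A\<close> with weights rescaled by \<open>?q\<close>.\<close>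
  let ?z = "(a * s / ?q) *\<^sub>R x + (b * t / ?q) *\<^sub>R y"
  have "?z \<in> A"
  proof (rule convexD[OF assms sx(2) ty(2)])
    show "0 \<le> a * s / ?q" "0 \<le> b * t / ?q" using q ab sx ty by simp_all
    show "a * s / ?q + b * t / ?q = 1" using q by (simp add: add_divide_distrib[symmetric])
  qed
  moreover have "a *\<^sub>R v + b *\<^sub>R w = ?q *\<^sub>R ?z" using q sx ty by (simp add: scaleR_add_right)
  ultimately show "a *\<^sub>R v + b *\<^sub>R w \<in> {s *\<^sub>R x |s x. s > 0 \<and> x \<in> A}" using q by blast
qed

lemma polar_coneD: "d \<in> polar_cone M \<Longrightarrow> x \<in> M \<Longrightarrow> inner x d \<le> 0"
  by (simp add: polar_cone_def)

lemma polar_cone_scaleR: "d \<in> polar_cone M \<Longrightarrow> s \<ge> 0 \<Longrightarrow> s *\<^sub>R d \<in> polar_cone M"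
  by (auto simp: polar_cone_def mult_nonneg_nonpos)

lemma convex_polar_cone: "convex (polar_cone M)"
  by (intro convexI) (auto simp: polar_cone_def inner_add_right intro!: add_nonpos_nonpos mult_nonneg_nonpos)

text \<open>
  This is a theorem of the alternative. The multipliers come out strictly positive because
  the sums are formed with positive weights before separating: if \<open>0\<close> is not in
  the convex set of all sums of a positive combination and a point of the bipolar cone of \<open>G\<close>,
  then a normal of a separating hyperplane is a nonzero element of both polar cones.
\<close>

lemma positive_multipliers_if_polar_trivial:
  fixes A :: "'i::finite \<Rightarrow> 'a::euclidean_space set"
  assumes convex: "\<And>i. convex (A i)" and nonempty: "\<And>i. A i \<noteq> {}"
    and trivial: "polar_cone (\<Union>i. A i) \<inter> polar_cone G \<subseteq> {0}"
  obtains \<xi> and l :: "'i \<Rightarrow> real"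
  where "\<And>i. \<xi> i \<in> A i" "\<And>i. l i > 0" "- (\<Sum>i\<in>UNIV. l i *\<^sub>R \<xi> i) \<in> polar_cone (polar_cone G)"
proof -
  let ?N = "polar_cone (polar_cone G)"
  define K where "K i = {s *\<^sub>R x |s x. s > 0 \<and> x \<in> A i}" for i
  define M where "M = {(\<Sum>i\<in>UNIV. v i) + n |v n. (\<forall>i. v i \<in> K i) \<and> n \<in> ?N}"
  have cK: "convex (K i)" for i unfolding K_def by (rule convex_positive_multiples[OF convex])
  have "convex M"
  proof (rule convexI)
    fix x y and a b :: real
    assume x: "x \<in> M" and y: "y \<in> M" and ab: "0 \<le> a" "0 \<le> b" "a + b = 1"
    from x y obtain v n w m where v: "\<And>i. v i \<in> K i" "n \<in> ?N" "x = sum v UNIV + n"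
      and w: "\<And>i. w i \<in> K i" "m \<in> ?N" "y = sum w UNIV + m"
      unfolding M_def by blast
    have "a *\<^sub>R x + b *\<^sub>R y = (\<Sum>i\<in>UNIV. a *\<^sub>R v i + b *\<^sub>R w i) + (a *\<^sub>R n + b *\<^sub>R m)"
      by (simp add: v w scaleR_add_right scaleR_sum_right sum.distrib)
    moreover have "a *\<^sub>R v i + b *\<^sub>R w i \<in> K i" for i using convexD[OF cK v(1) w(1) ab] .
    moreover have "a *\<^sub>R n + b *\<^sub>R m \<in> ?N" using convexD[OF convex_polar_cone v(2) w(2) ab] .
    ultimately show "a *\<^sub>R x + b *\<^sub>R y \<in> M" unfolding M_def by blast
  qed
  have "0 \<in> M"
  proof (rule ccontr)
    assume "0 \<notin> M"
    from separating_hyperplane_set_0[OF \<open>convex M\<close> this]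
    obtain e where e: "e \<noteq> 0" "\<And>x. x \<in> M \<Longrightarrow> 0 \<le> inner e x" by blast
    let ?d = "- e"
    have sep: "inner ?d (sum v UNIV) + inner ?d n \<le> 0"
      if "\<And>i. v i \<in> K i" "n \<in> ?N" for v n
    proof -
      have "sum v UNIV + n \<in> M" unfolding M_def using that by blast
      from e(2)[OF this] show ?thesis by (simp add: inner_add_right)
    qed
    define \<xi> where "\<xi> i = (SOME x. x \<in> A i)" for i
    have \<xi>: "\<xi> i \<in> A i" for i unfolding \<xi>_def some_in_eq by (rule nonempty)
    have K\<xi>: "s *\<^sub>R x \<in> K i" if "s > 0" "x \<in> A i" for s x i unfolding K_def using that by blast
    have zero_N: "0 \<in> ?N" by (simp add: polar_cone_def)
    \<comment> \<open>Weight \<open>s\<close> on \<open>x\<close> and fixed weights elsewhere: as \<open>s\<close> grows, the term of \<open>x\<close> decides the sign.\<close>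
    have "inner x ?d \<le> 0" if "x \<in> A i" for x i
    proof (rule slope_nonpos_of_bounded_ray)
      fix s :: real assume "s > 0"
      let ?v = "\<lambda>j. if j = i then s *\<^sub>R x else \<xi> j"
      have "?v j \<in> K j" for j
        using K\<xi>[OF \<open>s > 0\<close> that] K\<xi>[OF zero_less_one \<xi>] by simp
      from sep[OF this zero_N] have "inner ?d (sum ?v UNIV) \<le> 0" by simp
      moreover have "sum ?v UNIV = s *\<^sub>R x + (\<Sum>j\<in>UNIV - {i}. \<xi> j)"
        by (subst sum.remove[of _ i]) (auto intro!: sum.cong)
      ultimately show "inner ?d (\<Sum>j\<in>UNIV - {i}. \<xi> j) + s * inner x ?d \<le> 0"
        by (simp add: inner_add_right inner_commute)
    qed
    then have "?d \<in> polar_cone (\<Union>i. A i)" by (auto simp: polar_cone_def)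
    moreover have "inner x ?d \<le> 0" if "x \<in> G" for x
    proof (rule slope_nonpos_of_bounded_ray)
      fix s :: real assume "s > 0"
      have "x \<in> ?N" using that by (auto simp: polar_cone_def inner_commute)
      then have "s *\<^sub>R x \<in> ?N" using \<open>s > 0\<close> by (intro polar_cone_scaleR) auto
      moreover have "\<xi> j \<in> K j" for j using K\<xi>[OF zero_less_one \<xi>] by simp
      ultimately show "inner ?d (sum \<xi> UNIV) + s * inner x ?d \<le> 0"
        using sep[of \<xi> "s *\<^sub>R x"] by (simp add: inner_commute)
    qed
    then have "?d \<in> polar_cone G" by (auto simp: polar_cone_def)
    ultimately have "?d = 0" using trivial by blast
    with e(1) show False by simp
  qed
  then obtain v n where vn: "\<And>i. v i \<in> K i" "n \<in> ?N" "sum v UNIV + n = 0"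
    unfolding M_def by force
  have "\<forall>i. \<exists>s x. s > 0 \<and> x \<in> A i \<and> v i = s *\<^sub>R x" using vn(1) unfolding K_def by blast
  then obtain l \<xi> where l: "\<And>i. l i > 0" "\<And>i. \<xi> i \<in> A i" "\<And>i. v i = l i *\<^sub>R \<xi> i" by metis
  have "n = - (\<Sum>i\<in>UNIV. l i *\<^sub>R \<xi> i)" using vn(3) l(3) by (simp add: eq_neg_iff_add_eq_0 add.commute)
  with vn(2) l(1,2) show ?thesis using that by blast
qed

section \<open>Subgradients and descent of a convex function\<close>

lemma mem_subdiff_real:
  "\<xi> \<in> subdiff (\<lambda>y. ereal (h y)) x \<longleftrightarrow> (\<forall>y. h x + inner \<xi> (y - x) \<le> h y)"
  by (simp add: subdiff_def)

lemma convex_subdiff_real: "convex (subdiff (\<lambda>y. ereal (h y)) x)"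
proof (rule convexI)
  fix \<xi> \<eta> and a b :: real
  assume \<xi>: "\<xi> \<in> subdiff (\<lambda>y. ereal (h y)) x" and \<eta>: "\<eta> \<in> subdiff (\<lambda>y. ereal (h y)) x"
    and ab: "0 \<le> a" "0 \<le> b" "a + b = 1"
  have "h x + inner (a *\<^sub>R \<xi> + b *\<^sub>R \<eta>) (y - x) \<le> h y" for y
  proof -
    have "a * (h x + inner \<xi> (y - x)) + b * (h x + inner \<eta> (y - x)) \<le> a * h y + b * h y"
      using \<xi> \<eta> ab by (intro add_mono mult_left_mono) (auto simp: mem_subdiff_real)
    moreover have "a * h x + b * h x = h x" "a * h y + b * h y = h y"
      using ab by (metis distrib_right mult_1)+
    ultimately show ?thesis by (simp add: inner_add_left distrib_left)
  qed
  then show "a *\<^sub>R \<xi> + b *\<^sub>R \<eta> \<in> subdiff (\<lambda>y. ereal (h y)) x" by (simp add: mem_subdiff_real)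
qed

text \<open>
  If \<open>h\<close> does not decrease along a ray, the ray, placed at height \<open>h x\<close>, misses the strict
  epigraph of \<open>h\<close>. A separating hyperplane is not vertical because \<open>h\<close> is finite everywhere, so
  it is the graph of an affine function, and its slope is a subgradient with the required sign.
  For \<open>d = 0\<close> this is the nonemptiness of the subdifferential.
\<close>

lemma subgradient_of_no_descent:
  fixes h :: "'a::euclidean_space \<Rightarrow> real"
  assumes "convex_on UNIV h" and no_descent: "\<And>s. s > 0 \<Longrightarrow> h x \<le> h (x + s *\<^sub>R d)"
  obtains \<xi> where "\<xi> \<in> subdiff (\<lambda>y. ereal (h y)) x" "inner \<xi> d \<ge> 0"
proof -
  define E where "E = {(y, r). h y < r}"
  define R where "R = {(x + s *\<^sub>R d, h x) |s. s \<ge> 0}"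
  have "convex E"
  proof (rule convexI, clarsimp simp: E_def)
    fix y z r q and a b :: real
    assume *: "h y < r" "h z < q" "0 \<le> a" "0 \<le> b" "a + b = 1"
    have "h (a *\<^sub>R y + b *\<^sub>R z) \<le> a * h y + b * h z"
      using * assms(1) by (auto simp: convex_on_def)
    also have "\<dots> < a * r + b * q"
    proof (cases "a = 0")
      case False
      then show ?thesis using * by (intro add_less_le_mono mult_strict_left_mono mult_left_mono) auto
    qed (use * in auto)
    finally show "h (a *\<^sub>R y + b *\<^sub>R z) < a * r + b * q" .
  qed
  moreover have "convex R"
  proof (rule convexI)
    fix u w and a b :: real
    assume "u \<in> R" "w \<in> R" and ab: "0 \<le> a" "0 \<le> b" "a + b = 1"
    then obtain s t where st: "s \<ge> 0" "t \<ge> 0" "u = (x + s *\<^sub>R d, h x)" "w = (x + t *\<^sub>R d, h x)"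
      unfolding R_def by blast
    have b: "b = 1 - a" using ab by simp
    have "a *\<^sub>R u + b *\<^sub>R w = (x + (a * s + b * t) *\<^sub>R d, h x)"
      by (simp add: st b algebra_simps)
    moreover have "a * s + b * t \<ge> 0" using st ab by simp
    ultimately show "a *\<^sub>R u + b *\<^sub>R w \<in> R" unfolding R_def by blast
  qed
  moreover have "E \<noteq> {}" using less_add_one[of "h x"] unfolding E_def by blast
  moreover have "R \<noteq> {}" unfolding R_def by auto
  moreover have "R \<inter> E = {}"
    using no_descent by (force simp: E_def R_def order_le_less)
  ultimately obtain c \<beta> where c: "c \<noteq> 0" "\<forall>u\<in>R. inner c u \<le> \<beta>" "\<forall>u\<in>E. \<beta> \<le> inner c u"
    using separating_hyperplane_sets[of R E] by blast
  obtain a b where ab: "c = (a, b)" by (cases c)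
  have sep: "inner a (x + s *\<^sub>R d) + b * h x \<le> inner a y + b * r" if "s \<ge> 0" "h y < r" for s y r
  proof -
    have "(x + s *\<^sub>R d, h x) \<in> R" "(y, r) \<in> E" using that unfolding R_def E_def by auto
    then show ?thesis using c(2,3) unfolding ab by fastforce
  qed
  \<comment> \<open>The epigraph is unbounded upwards; \<open>b = 0\<close> would confine its projection to a half-space.\<close>
  have "b \<ge> 0"
    using sep[of 0 x "h x + 1"] by (simp add: algebra_simps)
  moreover have "b \<noteq> 0"
  proof
    assume "b = 0"
    with sep[of 0 "x - a" "h (x - a) + 1"] have "inner a a \<le> 0" by (simp add: inner_diff_right)
    then have "a = 0" by (metis antisym inner_eq_zero_iff inner_ge_zero)
    with \<open>b = 0\<close> c(1) ab show False by (simp add: zero_prod_def)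
  qed
  ultimately have b: "b > 0" by simp
  \<comment> \<open>Letting \<open>r\<close> decrease to \<open>h y\<close> moves the inequality to the boundary of the epigraph.\<close>
  have sep': "inner a (x + s *\<^sub>R d) + b * h x \<le> inner a y + b * h y" if "s \<ge> 0" for s y
  proof (rule field_le_epsilon)
    fix e :: real assume "e > 0"
    with sep[OF that, of y "h y + e / b"] b
    show "inner a (x + s *\<^sub>R d) + b * h x \<le> inner a y + b * h y + e" by (simp add: distrib_left)
  qed
  have "- (1 / b) *\<^sub>R a \<in> subdiff (\<lambda>y. ereal (h y)) x"
    unfolding mem_subdiff_real
  proof
    fix y
    show "h x + inner (- (1 / b) *\<^sub>R a) (y - x) \<le> h y"
      using sep'[of 0 y] b by (simp add: inner_diff_right field_simps)
  qed
  moreover have "inner (- (1 / b) *\<^sub>R a) d \<ge> 0"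
    using sep'[of 1 x] b by (simp add: inner_add_right divide_nonpos_pos)
  ultimately show ?thesis using that by blast
qed

text \<open>
  A contingent direction is only approached by the directions \<open>w r\<close> actually realised in \<open>M\<close>.
  Continuity at the fixed point \<open>x + s *\<^sub>R d\<close> keeps the decrease at \<open>x + s *\<^sub>R w r\<close>, and convexity
  pulls it back along the segment to the point of \<open>M\<close> at step length \<open>t r < s\<close>.
\<close>

lemma descent_along_contingent:
  fixes h :: "'a::euclidean_space \<Rightarrow> real"
  assumes h: "convex_on UNIV h" and d: "d \<in> contingent_cone M x"
    and s: "s > 0" "h (x + s *\<^sub>R d) < h x"
  obtains y where "y \<in> M" "h y < h x"
proof -
  from d obtain t :: "nat \<Rightarrow> real" and w where t: "\<And>r. t r > 0" "t \<longlonglongrightarrow> 0" and w: "w \<longlonglongrightarrow> d"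
    and M: "\<And>r. x + t r *\<^sub>R w r \<in> M"
    unfolding contingent_cone_def by blast
  have "continuous_on UNIV h" by (rule convex_on_continuous[OF open_UNIV h])
  then have "isCont h (x + s *\<^sub>R d)" by (simp add: continuous_on_eq_continuous_at)
  moreover have "(\<lambda>r. x + s *\<^sub>R w r) \<longlonglongrightarrow> x + s *\<^sub>R d" by (intro tendsto_intros w)
  ultimately have "(\<lambda>r. h (x + s *\<^sub>R w r)) \<longlonglongrightarrow> h (x + s *\<^sub>R d)" by (rule isCont_tendsto_compose)
  then have "\<forall>\<^sub>F r in sequentially. h (x + s *\<^sub>R w r) < h x" by (rule order_tendstoD(2)[OF _ s(2)])
  moreover have "\<forall>\<^sub>F r in sequentially. t r < s" by (rule order_tendstoD(2)[OF t(2) s(1)])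
  ultimately have "\<forall>\<^sub>F r in sequentially. h (x + s *\<^sub>R w r) < h x \<and> t r < s"
    by (rule eventually_conj)
  from eventually_happens'[OF sequentially_bot this]
  obtain r where r: "h (x + s *\<^sub>R w r) < h x" "t r < s" by blast
  let ?q = "t r / s"
  have q: "0 < ?q" "?q < 1" using t(1) r(2) s(1) by simp_all
  have "?q *\<^sub>R (x + s *\<^sub>R w r) = ?q *\<^sub>R x + t r *\<^sub>R w r"
    using s(1) by (simp add: scaleR_add_right)
  then have "x + t r *\<^sub>R w r = (1 - ?q) *\<^sub>R x + ?q *\<^sub>R (x + s *\<^sub>R w r)"
    by (simp add: scaleR_diff_left)
  then have "h (x + t r *\<^sub>R w r) \<le> (1 - ?q) * h x + ?q * h (x + s *\<^sub>R w r)"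
    using convex_onD[OF h, of ?q x "x + s *\<^sub>R w r"] q by simp
  also have "\<dots> < (1 - ?q) * h x + ?q * h x" 
    using r(1) q(1) by (intro add_strict_left_mono mult_strict_left_mono)
  also have "\<dots> = h x" by (simp add: algebra_simps)
  finally show ?thesis using that M by blast
qed

section \<open>The gap function and efficiency\<close>

lemma gap_nonpos_iff:
  "gap S x \<xi> l \<le> 0 \<longleftrightarrow> (\<forall>y\<in>S. 0 \<le> (\<Sum>i\<in>UNIV. l $ i * inner (\<xi> i) (y - x)))"
proof -
  have "(\<Sum>i\<in>UNIV. l $ i * inner (\<xi> i) (x - y)) = - (\<Sum>i\<in>UNIV. l $ i * inner (\<xi> i) (y - x))" for y
    by (simp add: inner_diff_right right_diff_distrib sum_subtractf)
  then show ?thesis by (simp add: gap_def SUP_le_iff)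
qed

lemma gap_eq_0_iff:
  assumes "x \<in> S"
  shows "gap S x \<xi> l = 0 \<longleftrightarrow> (\<forall>y\<in>S. 0 \<le> (\<Sum>i\<in>UNIV. l $ i * inner (\<xi> i) (y - x)))"
proof -
  have "0 \<le> gap S x \<xi> l" unfolding gap_def by (rule SUP_upper2[OF assms]) simp
  then show ?thesis unfolding gap_nonpos_iff[symmetric] by auto
qed

lemma efficient_of_gap_eq_0:
  fixes f :: "real ^ 'n \<Rightarrow> real ^ 'p"
  assumes x: "x \<in> S" and \<xi>: "\<And>i. \<xi> i \<in> obj_subdiff f i x" and l: "\<And>i. 0 < l $ i"
    and gap: "gap S x \<xi> l = 0"
  shows "efficient f S x"
  unfolding efficient_def
proof (intro conjI x notI)
  assume "\<exists>y\<in>S. (\<forall>i. f y $ i \<le> f x $ i) \<and> f y \<noteq> f x"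
  then obtain y k where y: "y \<in> S" "\<And>i. f y $ i \<le> f x $ i" "f y $ k \<noteq> f x $ k"
    by (auto simp: vec_eq_iff)
  have "0 \<le> (\<Sum>i\<in>UNIV. l $ i * inner (\<xi> i) (y - x))" using gap y(1) gap_eq_0_iff[OF x] by blast
  also have "\<dots> \<le> (\<Sum>i\<in>UNIV. l $ i * (f y $ i - f x $ i))"
  proof (intro sum_mono mult_left_mono)
    fix i
    have "f x $ i + inner (\<xi> i) (y - x) \<le> f y $ i"
      using \<xi>[of i] unfolding obj_subdiff_def mem_subdiff_real by blast
    then show "inner (\<xi> i) (y - x) \<le> f y $ i - f x $ i" by linarith
  qed (use l in \<open>simp add: less_imp_le\<close>)
  also have "\<dots> < (\<Sum>i\<in>(UNIV :: 'p set). 0)"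
  proof (rule sum_strict_mono_ex1)
    show "\<forall>i\<in>UNIV. l $ i * (f y $ i - f x $ i) \<le> 0"
      using l y(2) by (simp add: mult_nonneg_nonpos less_imp_le)
    have "l $ k * (f y $ k - f x $ k) < 0"
      using l[of k] y(2)[of k] y(3) by (intro mult_pos_neg) auto
    then show "\<exists>i\<in>UNIV. l $ i * (f y $ i - f x $ i) < 0" by blast
  qed simp
  finally show False by simp
qed

lemma feasible_direction_in_polar:
  assumes "y \<in> feasible_set g T"
  shows "y - x \<in> polar_cone (constr_grads g T x)"
proof -
  have "inner \<zeta> (y - x) \<le> 0" if "t \<in> active g T x" "\<zeta> \<in> subdiff (g t) x" for t \<zeta>
  proof -
    have "g t x + ereal (inner \<zeta> (y - x)) \<le> g t y" using that(2) unfolding subdiff_def by blast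
    also have "\<dots> \<le> 0" using assms that(1) by (simp add: feasible_set_def active_def)
    finally show ?thesis using that(1) by (simp add: active_def)
  qed
  then show ?thesis by (auto simp: polar_cone_def constr_grads_def)
qed

text \<open>
  Here the two qualifications meet: MOQ selects the index \<open>i\<close> of an objective that a nonzero
  direction in both polar cones would improve, and EADQ is applied to the set \<open>Q\<^sup>i\<close> of the
  same index, so that the improved point does not worsen any other objective.
\<close>

lemma polar_trivial_of_efficient:
  fixes f :: "real ^ 'n \<Rightarrow> real ^ 'p"
  assumes f: "\<And>i. convex_on UNIV (\<lambda>x. f x $ i)"
    and eff: "efficient f (feasible_set g T) x" and "EADQ f g T x" and "MOQ f x"
  shows "polar_cone (obj_grads f x) \<inter> polar_cone (constr_grads g T x) \<subseteq> {0}"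
proof (rule ccontr)
  assume "\<not> ?thesis"
  then obtain d where d: "d \<noteq> 0" "d \<in> polar_cone (obj_grads f x)"
    "d \<in> polar_cone (constr_grads g T x)" by blast
  obtain i where i: "d \<in> strict_polar_cone (obj_subdiff f i x)"
    using \<open>MOQ f x\<close> d(1,2) unfolding MOQ_def by blast
  have "\<exists>s>0. f (x + s *\<^sub>R d) $ i < f x $ i"
  proof (rule ccontr)
    assume "\<not> ?thesis"
    then have "f x $ i \<le> f (x + s *\<^sub>R d) $ i" if "s > 0" for s using that not_le by blast
    from subgradient_of_no_descent[OF f this]
    obtain \<xi> where "\<xi> \<in> obj_subdiff f i x" "inner \<xi> d \<ge> 0"
      unfolding obj_subdiff_def by blast
    with i show False unfolding strict_polar_cone_def by force
  qed
  then obtain s where s: "s > 0" "f (x + s *\<^sub>R d) $ i < f x $ i" by blast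
  have "d \<in> contingent_cone (Q_set f (feasible_set g T) i x) x"
    using \<open>EADQ f g T x\<close> d(2,3) unfolding EADQ_def by blast
  from descent_along_contingent[OF f this s]
  obtain y where y: "y \<in> Q_set f (feasible_set g T) i x" "f y $ i < f x $ i" by blast
  then have "y \<in> feasible_set g T" "\<forall>j. f y $ j \<le> f x $ j" "f y \<noteq> f x"
    unfolding Q_set_def by (auto intro: less_imp_le)
  with eff show False unfolding efficient_def by blast
qed

text \<open>
  The negative of the weighted sum of objective subgradients lies in the bipolar cone of the
  constraint subgradients, while each \<open>y - x\<close> with \<open>y\<close> feasible lies in their polar cone; so
  their inner product, which is the term of \<open>y\<close> in the gap function, is at most \<open>0\<close>.
\<close>

lemma gap_eq_0_of_efficient:
  fixes f :: "real ^ 'n \<Rightarrow> real ^ 'p"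
  assumes f: "\<And>i. convex_on UNIV (\<lambda>x. f x $ i)"
    and eff: "efficient f (feasible_set g T) x" and quals: "EADQ f g T x" "MOQ f x"
  shows "\<exists>\<xi> l. (\<forall>i. \<xi> i \<in> obj_subdiff f i x) \<and> (\<forall>i. 0 < l $ i) \<and>
    gap (feasible_set g T) x \<xi> l = 0"
proof -
  have convex: "convex (obj_subdiff f i x)" for i unfolding obj_subdiff_def by (rule convex_subdiff_real)
  have nonempty: "obj_subdiff f i x \<noteq> {}" for i
  proof -
    have "f x $ i \<le> f (x + s *\<^sub>R 0) $ i" for s by simp
    from subgradient_of_no_descent[OF f this] show ?thesis unfolding obj_subdiff_def by blast
  qed
  from positive_multipliers_if_polar_trivial[OF convex nonempty
      polar_trivial_of_efficient[OF f eff quals, unfolded obj_grads_def]]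
  obtain \<xi> and l :: "'p \<Rightarrow> real" where \<xi>: "\<And>i. \<xi> i \<in> obj_subdiff f i x" and l: "\<And>i. l i > 0"
    and neg: "- (\<Sum>i\<in>UNIV. l i *\<^sub>R \<xi> i) \<in> polar_cone (polar_cone (constr_grads g T x))" by blast
  have x: "x \<in> feasible_set g T" using eff unfolding efficient_def by blast
  have "gap (feasible_set g T) x \<xi> (\<chi> i. l i) = 0"
    unfolding gap_eq_0_iff[OF x]
  proof
    fix y assume "y \<in> feasible_set g T"
    from polar_coneD[OF neg feasible_direction_in_polar[OF this]]
    show "0 \<le> (\<Sum>i\<in>UNIV. (\<chi> i. l i) $ i * inner (\<xi> i) (y - x))"
      by (simp add: inner_sum_right inner_commute)
  qed
  with \<xi> l show ?thesis by (intro exI[of _ \<xi>] exI[of _ "\<chi> i. l i"]) simp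
qed

theorem theorem8:
  fixes f :: "real ^ 'n \<Rightarrow> real ^ 'p"
    and g :: "'t \<Rightarrow> real ^ 'n \<Rightarrow> ereal"
    and T :: "'t set"
    and xh :: "real ^ 'n"
  assumes p_ge_2: "CARD('p) \<ge> 2"
    and f_convex: "\<And>i. convex_on UNIV (\<lambda>x. f x $ i)"
    and T_infinite: "infinite T"
    and g_lsc: "\<And>t. t \<in> T \<Longrightarrow> lsc_fun (g t)"
    and g_proper: "\<And>t. t \<in> T \<Longrightarrow> proper_fun (g t)"
    and g_convex: "\<And>t. t \<in> T \<Longrightarrow> convex_fun (g t)"
    and feasible: "xh \<in> feasible_set g T"
  shows "((\<exists>\<xi> l. (\<forall>i. \<xi> i \<in> obj_subdiff f i xh) \<and> (\<forall>i. 0 < l $ i) \<and>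
              gap (feasible_set g T) xh \<xi> l = 0)
            \<longrightarrow> efficient f (feasible_set g T) xh)
       \<and> (efficient f (feasible_set g T) xh \<and> EADQ f g T xh \<and> MOQ f xh
            \<longrightarrow> (\<exists>\<xi> l. (\<forall>i. \<xi> i \<in> obj_subdiff f i xh) \<and> (\<forall>i. 0 < l $ i) \<and>
                   gap (feasible_set g T) xh \<xi> l = 0))"
proof (intro conjI impI; elim exE conjE)
  fix \<xi> and l :: "real ^ 'p"
  assume "\<forall>i. \<xi> i \<in> obj_subdiff f i xh" "\<forall>i. 0 < l $ i" "gap (feasible_set g T) xh \<xi> l = 0"
  then show "efficient f (feasible_set g T) xh" using efficient_of_gap_eq_0[OF feasible] by blast
next
  assume "efficient f (feasible_set g T) xh" "EADQ f g T xh" "MOQ f xh"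
  from gap_eq_0_of_efficient[OF f_convex this]
  show "\<exists>\<xi> l. (\<forall>i. \<xi> i \<in> obj_subdiff f i xh) \<and> (\<forall>i. 0 < l $ i) \<and>
      gap (feasible_set g T) xh \<xi> l = 0" .
qed

end
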